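(* Let $M$ and $N$ be two compact metric spaces and let $f:M\to M$, $g:N\to N$ be two continuous maps. Suppose there exists a homeomorphism $h:M\to N$ such that $h\circ f=g\circ h$. Then $o(f)=o(g)$.
   Context: Orders of growth. Let $\mathbb{N}=\{1,2,\dots\}$ and let $\mathcal{O}$ be the set of non-decreasing sequences $a:\mathbb{N}\to[0,\infty)$. For $a_1,a_2\in\mathcal{O}$ write $a_1\approx a_2$ if there are $c,C\in(0,\infty)$ with $c\,a_1(n)\le a_2(n)\le C\,a_1(n)$ for all $n$. Let $\mathbb{O}=\mathcal{O}/{\approx}$, and let $[a(n)]\in\mathbb{O}$ denote the class of $a$. Partially order $\mathbb{O}$ by: $[a_1(n)]\le[a_2(n)]$ iff there is $C>0$ with $a_1(n)\le C\,a_2(n)$ for all $n$. Let $\overline{\mathbb{O}}$ be the Dedekind–MacNeille completion of $(\mathbb{O},\le)$ (the smallest complete lattice containing $\mathbb{O}$), so $\mathbb{O}\subset\overline{\mathbb{O}}$. Generalized topological entropy. For a compact metric space $(M,d)$ and a continuous map $f:M\to M$, put $d_n(x,y)=\max\{d(f^i(x),f^i(y)):0\le i\le n\}$ and $B(x,n,\epsilon)=\{y\in M:d_n(x,y)\le\epsilon\}$. Let $g_{f,\epsilon}(n)$ be the minimal cardinality of a finite set $E\subset M$ with $M=\bigcup_{x\in E}B(x,n,\epsilon)$. Then $g_{f,\epsilon}\in\mathcal{O}$, and $o(f)=\sup\{[g_{f,\epsilon}(n)]:\epsilon>0\}\in\overline{\mathbb{O}}$. *)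

theory Defs
  imports "HOL-Analysis.Analysis"
begin

section \<open>Dedekind--MacNeille completion of a partial order\<close>

definition upper_bounds :: "'a::order set \<Rightarrow> 'a set" where
  "upper_bounds A = {u. \<forall>a\<in>A. a \<le> u}"

definition lower_bounds :: "'a::order set \<Rightarrow> 'a set" where
  "lower_bounds A = {l. \<forall>a\<in>A. l \<le> a}"

lemma lower_upper_increasing: "A \<subseteq> lower_bounds (upper_bounds A)"
  by (auto simp: lower_bounds_def upper_bounds_def)

lemma lower_upper_mono:
  "A \<subseteq> B \<Longrightarrow> lower_bounds (upper_bounds A) \<subseteq> lower_bounds (upper_bounds B)"
  by (auto simp: lower_bounds_def upper_bounds_def)

lemma lower_upper_lower: "lower_bounds (upper_bounds (lower_bounds A)) = lower_bounds A"
  by (auto simp: lower_bounds_def upper_bounds_def)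

text \<open>The completion is realised as the set of cuts, ordered by inclusion.\<close>

typedef (overloaded) 'a macneille = "{A :: 'a::order set. lower_bounds (upper_bounds A) = A}"
  morphisms cut_of Abs_macneille
  by (rule exI[of _ "lower_bounds {}"]) (simp add: lower_upper_lower)

lemma cut_of_closed: "lower_bounds (upper_bounds (cut_of x)) = cut_of x"
  using cut_of[of x] by simp

definition macneille_hull :: "'a::order set \<Rightarrow> 'a macneille" where
  "macneille_hull A = Abs_macneille (lower_bounds (upper_bounds A))"

lemma cut_of_hull: "cut_of (macneille_hull A) = lower_bounds (upper_bounds A)"
  by (simp add: macneille_hull_def Abs_macneille_inverse lower_upper_lower)

lemma hull_subset_iff: "lower_bounds (upper_bounds A) \<subseteq> cut_of x \<longleftrightarrow> A \<subseteq> cut_of x"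
  using lower_upper_increasing[of A] lower_upper_mono[of A "cut_of x"] cut_of_closed[of x]
  by auto

lemma hull_Inter:
  "lower_bounds (upper_bounds (\<Inter>x\<in>S. cut_of x)) = (\<Inter>x\<in>S. cut_of x)"
proof
  show "lower_bounds (upper_bounds (\<Inter>x\<in>S. cut_of x)) \<subseteq> (\<Inter>x\<in>S. cut_of x)"
    by (intro INT_greatest) (simp add: hull_subset_iff INF_lower)
qed (rule lower_upper_increasing)

instantiation macneille :: (order) complete_lattice
begin

definition less_eq_macneille :: "'a macneille \<Rightarrow> 'a macneille \<Rightarrow> bool" where
  "x \<le> y \<longleftrightarrow> cut_of x \<subseteq> cut_of y"

definition less_macneille :: "'a macneille \<Rightarrow> 'a macneille \<Rightarrow> bool" where
  "x < y \<longleftrightarrow> cut_of x \<subset> cut_of y"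

definition Inf_macneille :: "'a macneille set \<Rightarrow> 'a macneille" where
  "Inf S = macneille_hull (\<Inter>x\<in>S. cut_of x)"

definition Sup_macneille :: "'a macneille set \<Rightarrow> 'a macneille" where
  "Sup S = macneille_hull (\<Union>x\<in>S. cut_of x)"

definition inf_macneille :: "'a macneille \<Rightarrow> 'a macneille \<Rightarrow> 'a macneille" where
  "inf x y = Inf {x, y :: 'a macneille}"

definition sup_macneille :: "'a macneille \<Rightarrow> 'a macneille \<Rightarrow> 'a macneille" where
  "sup x y = Sup {x, y :: 'a macneille}"

definition bot_macneille :: "'a macneille" where "bot = Sup ({} :: 'a macneille set)"

definition top_macneille :: "'a macneille" where "top = Inf ({} :: 'a macneille set)"

instance
proof
  fix x y z :: "'a macneille" and S :: "'a macneille set"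
  note defs = less_eq_macneille_def less_macneille_def Inf_macneille_def Sup_macneille_def
    inf_macneille_def sup_macneille_def bot_macneille_def top_macneille_def cut_of_hull
    hull_Inter hull_subset_iff
  show "x < y \<longleftrightarrow> x \<le> y \<and> \<not> y \<le> x" by (auto simp: defs)
  show "x \<le> x" by (simp add: defs)
  show "x \<le> y \<Longrightarrow> y \<le> z \<Longrightarrow> x \<le> z" by (auto simp: defs)
  show "x \<le> y \<Longrightarrow> y \<le> x \<Longrightarrow> x = y" by (simp add: defs cut_of_inject[symmetric])
  have Sup_upper: "v \<in> T \<Longrightarrow> v \<le> Sup T" for v :: "'a macneille" and T
    using lower_upper_increasing[of "\<Union>x\<in>T. cut_of x"] by (auto simp: defs)
  have Inf_eq: "cut_of (Inf T) = (\<Inter>x\<in>T. cut_of x)" for T :: "'a macneille set"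
    using hull_Inter[of T] by (simp add: Inf_macneille_def cut_of_hull)
  show "inf x y \<le> x" "inf x y \<le> y"
    by (auto simp: less_eq_macneille_def inf_macneille_def Inf_eq)
  show "x \<le> y \<Longrightarrow> x \<le> z \<Longrightarrow> x \<le> inf y z"
    by (auto simp: less_eq_macneille_def inf_macneille_def Inf_eq)
  show "x \<le> sup x y" "y \<le> sup x y"
    using Sup_upper by (auto simp: sup_macneille_def)
  show "y \<le> x \<Longrightarrow> z \<le> x \<Longrightarrow> sup y z \<le> x" by (simp add: defs)
  show "x \<in> S \<Longrightarrow> Inf S \<le> x" by (auto simp: less_eq_macneille_def Inf_eq)
  show "(\<And>x. x \<in> S \<Longrightarrow> z \<le> x) \<Longrightarrow> z \<le> Inf S"
    by (auto simp: less_eq_macneille_def Inf_eq)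
  show "x \<in> S \<Longrightarrow> x \<le> Sup S" by (rule Sup_upper)
  show "(\<And>x. x \<in> S \<Longrightarrow> x \<le> z) \<Longrightarrow> Sup S \<le> z"
    by (auto simp: less_eq_macneille_def Sup_macneille_def cut_of_hull hull_subset_iff)
  show "Inf {} = (top :: 'a macneille)" by (simp add: top_macneille_def)
  show "Sup {} = (bot :: 'a macneille)" by (simp add: bot_macneille_def)
qed

end

definition macneille_embed :: "'a::order \<Rightarrow> 'a macneille" where
  "macneille_embed x = Abs_macneille {y. y \<le> x}"

lemma principal_eq: "{y. y \<le> x} = lower_bounds {x::'a::order}"
  by (simp add: lower_bounds_def)

lemma cut_of_embed: "cut_of (macneille_embed x) = {y. y \<le> x}"
  unfolding macneille_embed_def principal_eq
  by (rule Abs_macneille_inverse) (simp add: lower_upper_lower)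

lemma macneille_embed_le_iff: "macneille_embed x \<le> macneille_embed y \<longleftrightarrow> x \<le> y"
  by (auto simp: less_eq_macneille_def cut_of_embed)

text \<open>Minimality: every complete lattice containing the order contains the completion.\<close>

lemma macneille_smallest:
  fixes e :: "'a::order \<Rightarrow> 'l::complete_lattice"
  assumes e: "\<And>x y. e x \<le> e y \<longleftrightarrow> x \<le> y"
  shows "\<exists>\<phi> :: 'a macneille \<Rightarrow> 'l.
    (\<forall>X Y. \<phi> X \<le> \<phi> Y \<longleftrightarrow> X \<le> Y) \<and> (\<forall>x. \<phi> (macneille_embed x) = e x)"
proof (intro exI[of _ "\<lambda>X. SUP a\<in>cut_of X. e a"] conjI allI)
  fix X Y :: "'a macneille"
  show "(SUP a\<in>cut_of X. e a) \<le> (SUP a\<in>cut_of Y. e a) \<longleftrightarrow> X \<le> Y"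
  proof
    assume le: "(SUP a\<in>cut_of X. e a) \<le> (SUP a\<in>cut_of Y. e a)"
    have "a \<le> u" if a: "a \<in> cut_of X" and u: "u \<in> upper_bounds (cut_of Y)" for a u
    proof -
      have "e a \<le> (SUP a\<in>cut_of X. e a)" using a by (rule SUP_upper)
      also note le
      also have "(SUP a\<in>cut_of Y. e a) \<le> e u"
        using u by (intro SUP_least) (simp add: e upper_bounds_def)
      finally show ?thesis by (simp add: e)
    qed
    then have "cut_of X \<subseteq> lower_bounds (upper_bounds (cut_of Y))"
      by (auto simp: lower_bounds_def)
    then show "X \<le> Y" by (simp add: less_eq_macneille_def cut_of_closed)
  next
    assume "X \<le> Y"
    then show "(SUP a\<in>cut_of X. e a) \<le> (SUP a\<in>cut_of Y. e a)"
      by (intro SUP_subset_mono) (auto simp: less_eq_macneille_def)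
  qed
next
  fix x
  show "(SUP a\<in>cut_of (macneille_embed x). e a) = e x"
    by (rule antisym) (auto simp: cut_of_embed e intro!: SUP_least SUP_upper)
qed


section \<open>Orders of growth\<close>

text \<open>Sequences indexed by the positive integers; the value at \<open>0\<close> is ignored throughout.\<close>

definition growth_seqs :: "(nat \<Rightarrow> real) set" where
  "growth_seqs = {a. (\<forall>n\<ge>1. 0 \<le> a n) \<and> mono_on {1..} a}"

definition growth_eq :: "(nat \<Rightarrow> real) \<Rightarrow> (nat \<Rightarrow> real) \<Rightarrow> bool" where
  "growth_eq a b \<longleftrightarrow> a \<in> growth_seqs \<and> b \<in> growth_seqs \<and>
     (\<exists>c>0. \<exists>C>0. \<forall>n\<ge>1. c * a n \<le> b n \<and> b n \<le> C * a n)"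

definition growth_le :: "(nat \<Rightarrow> real) \<Rightarrow> (nat \<Rightarrow> real) \<Rightarrow> bool" where
  "growth_le a b \<longleftrightarrow> (\<exists>C>0. \<forall>n\<ge>1. a n \<le> C * b n)"

lemma growth_le_refl: "growth_le a a"
  unfolding growth_le_def by (rule exI[of _ 1]) simp

lemma growth_le_trans:
  assumes "growth_le a b" "growth_le b c"
  shows "growth_le a c"
proof -
  obtain C where C: "C > 0" "\<And>n. n \<ge> 1 \<Longrightarrow> a n \<le> C * b n"
    using assms(1) by (auto simp: growth_le_def)
  obtain D where D: "D > 0" "\<And>n. n \<ge> 1 \<Longrightarrow> b n \<le> D * c n"
    using assms(2) by (auto simp: growth_le_def)
  have "a n \<le> (C * D) * c n" if "n \<ge> 1" for n
  proof -
    have "C * b n \<le> C * (D * c n)" using C(1) D(2)[OF that] by simp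
    with C(2)[OF that] show ?thesis by (simp add: mult.assoc)
  qed
  then show ?thesis
    unfolding growth_le_def using C(1) D(1) by (intro exI[of _ "C * D"]) simp
qed

lemma growth_eq_iff_le:
  "growth_eq a b \<longleftrightarrow> a \<in> growth_seqs \<and> b \<in> growth_seqs \<and> growth_le a b \<and> growth_le b a"
proof -
  have "(\<exists>c>0. \<forall>n\<ge>1. c * a n \<le> b n) \<longleftrightarrow> growth_le a b"
  proof
    assume "\<exists>c>0. \<forall>n\<ge>1. c * a n \<le> b n"
    then obtain c where "c > 0" "\<forall>n\<ge>1. c * a n \<le> b n" by blast
    then show "growth_le a b"
      unfolding growth_le_def by (intro exI[of _ "inverse c"]) (simp add: field_simps)
  next
    assume "growth_le a b"
    then obtain C where "C > 0" "\<forall>n\<ge>1. a n \<le> C * b n" unfolding growth_le_def by blast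
    then show "\<exists>c>0. \<forall>n\<ge>1. c * a n \<le> b n"
      by (intro exI[of _ "inverse C"]) (simp add: field_simps)
  qed
  then show ?thesis unfolding growth_eq_def growth_le_def by blast
qed

quotient_type growth = "nat \<Rightarrow> real" / partial: growth_eq
  morphisms rep_growth growth_class
proof (rule part_equivpI)
  have "(\<lambda>_. 0) \<in> growth_seqs" by (simp add: growth_seqs_def mono_on_def)
  then show "\<exists>a. growth_eq a a"
    by (intro exI[of _ "\<lambda>_. 0"]) (simp add: growth_eq_iff_le growth_le_refl)
  show "symp growth_eq" by (auto simp: symp_def growth_eq_iff_le)
  show "transp growth_eq"
    unfolding transp_def growth_eq_iff_le using growth_le_trans by blast
qed

instantiation growth :: order
begin

lift_definition less_eq_growth :: "growth \<Rightarrow> growth \<Rightarrow> bool" is growth_le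
  unfolding growth_eq_iff_le using growth_le_trans by blast

definition less_growth :: "growth \<Rightarrow> growth \<Rightarrow> bool" where
  "less_growth x y \<longleftrightarrow> x \<le> y \<and> \<not> y \<le> x"

instance
proof
  fix x y z :: growth
  show "x < y \<longleftrightarrow> x \<le> y \<and> \<not> y \<le> x" by (rule less_growth_def)
  show "x \<le> x" by transfer (rule growth_le_refl)
  show "x \<le> y \<Longrightarrow> y \<le> z \<Longrightarrow> x \<le> z" by transfer (rule growth_le_trans)
  show "x \<le> y \<Longrightarrow> y \<le> x \<Longrightarrow> x = y" by transfer (simp add: growth_eq_iff_le)
qed

end

lemma growth_class_le_iff:
  assumes "a \<in> growth_seqs" "b \<in> growth_seqs"
  shows "growth_class a \<le> growth_class b \<longleftrightarrow> (\<exists>C>0. \<forall>n\<ge>1. a n \<le> C * b n)"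
proof -
  have "growth_eq a a" "growth_eq b b"
    using assms by (simp_all add: growth_eq_iff_le growth_le_refl)
  then show ?thesis
    by (simp add: less_eq_growth.abs_eq growth_le_def)
qed


section \<open>Generalized topological entropy\<close>

definition bowen_dist :: "('a::metric_space \<Rightarrow> 'a) \<Rightarrow> nat \<Rightarrow> 'a \<Rightarrow> 'a \<Rightarrow> real" where
  "bowen_dist f n x y = Max ((\<lambda>i. dist ((f ^^ i) x) ((f ^^ i) y)) ` {0..n})"

definition bowen_ball :: "'a::metric_space set \<Rightarrow> ('a \<Rightarrow> 'a) \<Rightarrow> 'a \<Rightarrow> nat \<Rightarrow> real \<Rightarrow> 'a set" where
  "bowen_ball M f x n \<epsilon> = {y \<in> M. bowen_dist f n x y \<le> \<epsilon>}"

definition is_spanning ::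
  "'a::metric_space set \<Rightarrow> ('a \<Rightarrow> 'a) \<Rightarrow> real \<Rightarrow> nat \<Rightarrow> 'a set \<Rightarrow> bool" where
  "is_spanning M f \<epsilon> n E \<longleftrightarrow> finite E \<and> E \<subseteq> M \<and> M = (\<Union>x\<in>E. bowen_ball M f x n \<epsilon>)"

definition spanning_number :: "'a::metric_space set \<Rightarrow> ('a \<Rightarrow> 'a) \<Rightarrow> real \<Rightarrow> nat \<Rightarrow> nat" where
  "spanning_number M f \<epsilon> n = (LEAST k. \<exists>E. is_spanning M f \<epsilon> n E \<and> card E = k)"

definition gen_entropy :: "'a::metric_space set \<Rightarrow> ('a \<Rightarrow> 'a) \<Rightarrow> growth macneille" where
  "gen_entropy M f =
     (SUP \<epsilon>\<in>{0<..}. macneille_embed (growth_class (\<lambda>n. real (spanning_number M f \<epsilon> n))))"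

text \<open>For continuous self-maps of compact spaces the minimum is attained and the spanning
  numbers form a sequence in \<^term>\<open>growth_seqs\<close>, so \<^term>\<open>gen_entropy\<close> is meaningful.\<close>

lemma bowen_dist_le_iff:
  "bowen_dist f n x y \<le> \<epsilon> \<longleftrightarrow> (\<forall>i\<le>n. dist ((f ^^ i) x) ((f ^^ i) y) \<le> \<epsilon>)"
  unfolding bowen_dist_def by (subst Max_le_iff) auto

lemma continuous_on_funpow:
  fixes f :: "'a::topological_space \<Rightarrow> 'a"
  assumes "continuous_on M f" "f \<in> M \<rightarrow> M"
  shows "continuous_on M (f ^^ i) \<and> (f ^^ i) \<in> M \<rightarrow> M"
proof (induction i)
  case (Suc i)
  then have "continuous_on M (f \<circ> (f ^^ i))"
    using assms by (intro continuous_on_compose) (auto intro: continuous_on_subset)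
  with Suc assms(2) show ?case by auto
qed (auto simp: id_def)

lemma spanning_exists:
  fixes f :: "'a::metric_space \<Rightarrow> 'a"
  assumes "compact M" "continuous_on M f" "f \<in> M \<rightarrow> M" "\<epsilon> > 0"
  shows "\<exists>E. is_spanning M f \<epsilon> n E"
proof -
  define U where "U x = (\<Inter>i\<in>{..n}. M \<inter> (f ^^ i) -` ball ((f ^^ i) x) \<epsilon>)" for x
  have U_open: "openin (top_of_set M) (U x)" for x
    unfolding U_def
    using continuous_on_funpow[OF assms(2,3)]
    by (intro openin_INT2) (auto intro: continuous_openin_preimage_gen)
  have "\<exists>D\<subseteq>U ` M. finite D \<and> M \<subseteq> \<Union>D"
  proof (rule assms(1)[unfolded compact_eq_openin_cover, rule_format])
    show "(\<forall>c\<in>U ` M. openin (top_of_set M) c) \<and> M \<subseteq> \<Union> (U ` M)"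
      using U_open assms(4) by (auto simp: U_def)
  qed
  then obtain E where E: "finite E" "E \<subseteq> M" "M \<subseteq> (\<Union>x\<in>E. U x)"
    by (metis finite_subset_image)
  have "U x \<subseteq> bowen_ball M f x n \<epsilon>" for x
    by (auto simp: U_def bowen_ball_def bowen_dist_le_iff intro: less_imp_le)
  with E have "is_spanning M f \<epsilon> n E"
    unfolding is_spanning_def bowen_ball_def by blast
  then show ?thesis ..
qed

lemma spanning_number_in_growth_seqs:
  fixes f :: "'a::metric_space \<Rightarrow> 'a"
  assumes "compact M" "continuous_on M f" "f \<in> M \<rightarrow> M" "\<epsilon> > 0"
  shows "(\<lambda>n. real (spanning_number M f \<epsilon> n)) \<in> growth_seqs"
proof -
  have "spanning_number M f \<epsilon> m \<le> spanning_number M f \<epsilon> n" if "m \<le> n" for m n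
  proof -
    have ex: "\<exists>k E. is_spanning M f \<epsilon> n E \<and> card E = k"
      using spanning_exists[OF assms] by blast
    have "\<exists>E. is_spanning M f \<epsilon> n E \<and> card E = spanning_number M f \<epsilon> n"
      using LeastI_ex[OF ex] unfolding spanning_number_def .
    then obtain E where E: "is_spanning M f \<epsilon> n E" "card E = spanning_number M f \<epsilon> n"
      by blast
    have "bowen_ball M f x n \<epsilon> \<subseteq> bowen_ball M f x m \<epsilon>" for x
      using that by (auto simp: bowen_ball_def bowen_dist_le_iff)
    then have "(\<Union>x\<in>E. bowen_ball M f x n \<epsilon>) \<subseteq> (\<Union>x\<in>E. bowen_ball M f x m \<epsilon>)"
      by (rule UN_mono[OF subset_refl])
    moreover have "(\<Union>x\<in>E. bowen_ball M f x m \<epsilon>) \<subseteq> M"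
      by (auto simp: bowen_ball_def)
    ultimately have m: "is_spanning M f \<epsilon> m E"
      using E(1) unfolding is_spanning_def by (intro conjI equalityI) simp_all
    have "spanning_number M f \<epsilon> m \<le> card E"
      unfolding spanning_number_def by (rule Least_le) (use m in blast)
    then show ?thesis by (simp add: E(2))
  qed
  then show ?thesis by (simp add: growth_seqs_def mono_on_def)
qed

end

theory Submission
  imports Defs
begin

text \<open>
  Generalized entropy cannot increase under factors: if \<open>h\<close> maps \<open>M\<close> continuously onto \<open>N\<close> and
  carries the \<open>f\<close>-dynamics to the \<open>g\<close>-dynamics, then \<open>gen_entropy N g \<le> gen_entropy M f\<close>
  (\<open>gen_entropy_factor_le\<close>). Indeed \<open>h\<close> is uniformly continuous on the compact space \<open>M\<close>, so for
  each scale \<open>\<epsilon>\<close> in \<open>N\<close> there is a scale \<open>\<delta>\<close> in \<open>M\<close> such that \<open>\<delta>\<close>-closeness in \<open>M\<close> implies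
  \<open>\<epsilon>\<close>-closeness of the images. This \<open>\<delta>\<close> does not depend on the time horizon, because \<open>h\<close> sends
  the whole \<open>f\<close>-orbit of a point to the \<open>g\<close>-orbit of its image and the same modulus of continuity
  serves at every time. Hence \<open>h\<close> takes a \<open>(\<delta>, n)\<close>-spanning set to an \<open>(\<epsilon>, n)\<close>-spanning set for
  all \<open>n\<close> at once, and every order of growth entering the supremum for \<open>g\<close> is dominated by one
  entering the supremum for \<open>f\<close>. A conjugacy makes each system a factor of the other, so both
  inequalities hold, and antisymmetry in the completion gives equality.
\<close>

lemma funpow_semiconj:
  assumes "f \<in> M \<rightarrow> M" and "\<And>x. x \<in> M \<Longrightarrow> h (f x) = g (h x)" and "x \<in> M"
  shows "(f ^^ i) x \<in> M \<and> h ((f ^^ i) x) = (g ^^ i) (h x)"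
  by (induction i) (use assms in auto)

text \<open>
  A pair of points that stays \<open>\<delta>\<close>-close up to time \<open>n\<close> is mapped to a pair that stays
  \<open>\<epsilon>\<close>-close up to time \<open>n\<close>, since the modulus applies at each time separately; and
  surjectivity of \<open>h\<close> makes the image balls cover all of \<open>N\<close>.
\<close>

lemma is_spanning_image:
  assumes "f \<in> M \<rightarrow> M" and onto: "h ` M = N"
    and semiconj: "\<And>x. x \<in> M \<Longrightarrow> h (f x) = g (h x)"
    and modulus: "\<And>x y. x \<in> M \<Longrightarrow> y \<in> M \<Longrightarrow> dist x y \<le> \<delta> \<Longrightarrow> dist (h x) (h y) \<le> \<epsilon>"
    and E: "is_spanning M f \<delta> n E"
  shows "is_spanning N g \<epsilon> n (h ` E)"
proof -
  note orbit = funpow_semiconj[where h = h and g = g, OF assms(1) semiconj]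
  have "\<exists>x\<in>E. h y \<in> bowen_ball N g (h x) n \<epsilon>" if "y \<in> M" for y
  proof -
    obtain x where x: "x \<in> E" "x \<in> M" "y \<in> bowen_ball M f x n \<delta>"
      using E \<open>y \<in> M\<close> unfolding is_spanning_def by blast
    have "dist ((g ^^ i) (h x)) ((g ^^ i) (h y)) \<le> \<epsilon>" if "i \<le> n" for i
      using x that \<open>y \<in> M\<close> modulus[of "(f ^^ i) x" "(f ^^ i) y"] orbit[of x i] orbit[of y i]
      by (simp add: bowen_ball_def bowen_dist_le_iff)
    then show ?thesis
      using x onto \<open>y \<in> M\<close> by (auto simp: bowen_ball_def bowen_dist_le_iff)
  qed
  then have "N \<subseteq> (\<Union>x\<in>h ` E. bowen_ball N g x n \<epsilon>)"
    using onto by blast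
  moreover have "(\<Union>x\<in>h ` E. bowen_ball N g x n \<epsilon>) \<subseteq> N"
    by (auto simp: bowen_ball_def)
  moreover have "finite (h ` E)" "h ` E \<subseteq> N"
    using E onto unfolding is_spanning_def by (simp, blast)
  ultimately show ?thesis
    unfolding is_spanning_def by (intro conjI equalityI)
qed

lemma spanning_number_le_card:
  assumes "is_spanning M f \<epsilon> n E"
  shows "spanning_number M f \<epsilon> n \<le> card E"
  unfolding spanning_number_def by (rule Least_le) (use assms in blast)

lemma spanning_number_attained:
  assumes "compact M" "continuous_on M f" "f \<in> M \<rightarrow> M" "\<epsilon> > 0"
  obtains E where "is_spanning M f \<epsilon> n E" "card E = spanning_number M f \<epsilon> n"
proof -
  have "\<exists>k E. is_spanning M f \<epsilon> n E \<and> card E = k"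
    using spanning_exists[OF assms] by blast
  from LeastI_ex[OF this] show thesis
    using that unfolding spanning_number_def by blast
qed

text \<open>
  The point is the order of quantifiers: \<open>\<delta>\<close> is chosen before \<open>n\<close>, which is what makes the
  comparison one between orders of growth.
\<close>

lemma spanning_number_factor_le:
  assumes "compact M" "continuous_on M f" "f \<in> M \<rightarrow> M"
    and "continuous_on M h" "h ` M = N" and "\<And>x. x \<in> M \<Longrightarrow> h (f x) = g (h x)"
    and "\<epsilon> > 0"
  shows "\<exists>\<delta>>0. \<forall>n. spanning_number N g \<epsilon> n \<le> spanning_number M f \<delta> n"
proof -
  have "uniformly_continuous_on M h"
    using assms by (intro compact_uniformly_continuous)
  then obtain d where d: "d > 0" "\<And>x y. x \<in> M \<Longrightarrow> y \<in> M \<Longrightarrow> dist x y < d \<Longrightarrow> dist (h x) (h y) < \<epsilon>"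
    using \<open>\<epsilon> > 0\<close> unfolding uniformly_continuous_on_def by metis
  show ?thesis
  proof (intro exI conjI allI)
    \<comment> \<open>Halving turns the strict bound of uniform continuity into one valid on the closed Bowen
      balls.\<close>
    show "d / 2 > 0" using d(1) by simp
    fix n
    obtain E where E: "is_spanning M f (d / 2) n E" "card E = spanning_number M f (d / 2) n"
      using spanning_number_attained[OF assms(1-3) \<open>d / 2 > 0\<close>] .
    have "dist (h x) (h y) \<le> \<epsilon>" if "x \<in> M" "y \<in> M" "dist x y \<le> d / 2" for x y
      using d(2)[of x y] d(1) that by simp
    from is_spanning_image[where g = g, OF assms(3,5,6) this E(1)]
    have "is_spanning N g \<epsilon> n (h ` E)" .
    then have "spanning_number N g \<epsilon> n \<le> card (h ` E)"
      by (rule spanning_number_le_card)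
    also have "\<dots> \<le> card E"
      using E(1) by (intro card_image_le) (simp add: is_spanning_def)
    finally show "spanning_number N g \<epsilon> n \<le> spanning_number M f (d / 2) n"
      by (simp add: E(2))
  qed
qed

lemma gen_entropy_factor_le:
  assumes M: "compact M" "continuous_on M f" "f \<in> M \<rightarrow> M"
    and N: "continuous_on N g" "g \<in> N \<rightarrow> N"
    and h: "continuous_on M h" "h ` M = N" "\<And>x. x \<in> M \<Longrightarrow> h (f x) = g (h x)"
  shows "gen_entropy N g \<le> gen_entropy M f"
  unfolding gen_entropy_def
proof (rule SUP_mono)
  fix \<epsilon> :: real
  assume "\<epsilon> \<in> {0<..}"
  then have "\<epsilon> > 0" by simp
  have "compact N"
    using compact_continuous_image[OF h(1) M(1)] h(2) by simp
  obtain \<delta> where \<delta>: "\<delta> > 0" "\<And>n. spanning_number N g \<epsilon> n \<le> spanning_number M f \<delta> n"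
    using spanning_number_factor_le[where g = g, OF M h \<open>\<epsilon> > 0\<close>] by blast
  have "growth_class (\<lambda>n. real (spanning_number N g \<epsilon> n))
      \<le> growth_class (\<lambda>n. real (spanning_number M f \<delta> n))"
    using \<delta> spanning_number_in_growth_seqs[OF \<open>compact N\<close> N \<open>\<epsilon> > 0\<close>]
      spanning_number_in_growth_seqs[OF M \<open>\<delta> > 0\<close>]
    by (subst growth_class_le_iff) (auto intro!: exI[of _ 1])
  with \<open>\<delta> > 0\<close> show "\<exists>\<delta>\<in>{0<..}. macneille_embed (growth_class (\<lambda>n. real (spanning_number N g \<epsilon> n)))
      \<le> macneille_embed (growth_class (\<lambda>n. real (spanning_number M f \<delta> n)))"
    by (auto simp: macneille_embed_le_iff)
qed

theorem theorem1:
  fixes M :: "'a::metric_space set" and N :: "'b::metric_space set"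
    and f :: "'a \<Rightarrow> 'a" and g :: "'b \<Rightarrow> 'b"
  assumes "compact M" and "compact N"
    and "continuous_on M f" and "f \<in> M \<rightarrow> M"
    and "continuous_on N g" and "g \<in> N \<rightarrow> N"
    and "\<exists>h k. homeomorphism M N h k \<and> (\<forall>x\<in>M. h (f x) = g (h x))"
  shows "gen_entropy M f = gen_entropy N g"
proof -
  obtain h k where hk: "homeomorphism M N h k" and conj: "\<And>x. x \<in> M \<Longrightarrow> h (f x) = g (h x)"
    using assms(7) by blast
  have h: "continuous_on M h" "h ` M = N" and k: "continuous_on N k" "k ` N = M"
    and kh: "\<And>x. x \<in> M \<Longrightarrow> k (h x) = x" and hk_id: "\<And>y. y \<in> N \<Longrightarrow> h (k y) = y"
    using hk by (auto simp: homeomorphism_def)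
  have conj_inv: "k (g y) = f (k y)" if "y \<in> N" for y
  proof -
    have "k y \<in> M" using that k(2) by blast
    then have "f (k y) \<in> M" using assms(4) by blast
    then have "f (k y) = k (h (f (k y)))" by (simp add: kh)
    also have "\<dots> = k (g y)" using conj[OF \<open>k y \<in> M\<close>] hk_id[OF that] by simp
    finally show ?thesis by simp
  qed
  show ?thesis
  proof (rule antisym)
    show "gen_entropy M f \<le> gen_entropy N g"
      by (rule gen_entropy_factor_le[where h = k, OF assms(2,5,6,3,4) k conj_inv])
    show "gen_entropy N g \<le> gen_entropy M f"
      by (rule gen_entropy_factor_le[where h = h, OF assms(1,3,4,5,6) h conj])
  qed
qed

end
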